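(* Let $\{W(k)\}_{k\ge 0}$ be an independent random model of $m\times m$ stochastic matrices that has a common steady state $\pi>0$ in expectation and weak feedback property. Then the following conditions are equivalent: (a) The model $\{W(k)\}$ is ergodic. (b) The model $\{W(k)\}$ has infinite flow property. (c) The expected model $\{\mathsf{E}[W(k)]\}$ has infinite flow property. (d) The expected model $\{\mathsf{E}[W(k)]\}$ is ergodic.
   Context: $[m]=\{1,\dots,m\}$; a subset $S\subset[m]$ is nontrivial if it is nonempty and proper; $\bar S=[m]\setminus S$. Stochastic matrix means row-stochastic: nonnegative entries and all row sums equal to $1$. A random model (random chain) $\{W(k)\}_{k\ge0}$ is a sequence of random $m\times m$ stochastic matrices on a probability space; it is independent if the $\sigma$-algebras generated by the $W(k)$, $k\ge0$, are independent. The expected model is the deterministic sequence of stochastic matrices $\{\mathsf{E}[W(k)]\}_{k\ge0}$ (entrywise expectation). A deterministic chain $\{G(k)\}_{k\ge0}$ of $m\times m$ stochastic matrices is ergodic if for every $t\ge0$ and $j\in[m]$ there is a scalar $g_j(t)$ with $\lim_{k\to\infty}[G(k)G(k-1)\cdots G(t)]_{ij}=g_j(t)$ for all $i\in[m]$. It has infinite flow property if $\sum_{k=0}^\infty\sum_{i\in S,\,j\in\bar S}(G_{ij}(k)+G_{ji}(k))=\infty$ for every nontrivial $S\subset[m]$. A random model is ergodic (respectively, has infinite flow property) if its realization is an ergodic chain (respectively, a chain with infinite flow property) almost surely. The model has a common steady state $\pi$ in expectation if $\pi\in\mathbb{R}^m$ is a stochastic vector (nonnegative entries summing to $1$) with $\pi^T\mathsf{E}[W(k)]=\pi^T$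 for all $k\ge0$; $\pi>0$ means all entries are positive. The model has weak feedback property if there is $\gamma>0$ such that $\mathsf{E}[(W^i(k))^TW^j(k)]\ge\gamma(\mathsf{E}[W_{ij}(k)]+\mathsf{E}[W_{ji}(k)])$ for all $k\ge0$ and all $i\ne j$ in $[m]$, where $W^i(k)$ denotes the $i$th column of $W(k)$. *)

theory Defs
  imports "HOL-Probability.Probability"
begin

(* The index set [m] is the finite type 'n, so m = CARD('n) \<ge> 1. *)

definition stochastic_vector :: "real^'n \<Rightarrow> bool" where
  "stochastic_vector v \<longleftrightarrow> (\<forall>i. 0 \<le> v $ i) \<and> (\<Sum>i\<in>UNIV. v $ i) = 1"

definition stochastic_matrix :: "real^'n^'n \<Rightarrow> bool" where
  "stochastic_matrix A \<longleftrightarrow> (\<forall>i j. 0 \<le> A $ i $ j) \<and> (\<forall>i. (\<Sum>j\<in>UNIV. A $ i $ j) = 1)"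

(* The product G k ** ... ** G (t + 1) ** G t for k \<ge> t; it is the identity for k < t,
   which does not matter for the limit k \<rightarrow> \<infinity>. *)
definition backward_product :: "(nat \<Rightarrow> real^'n^'n) \<Rightarrow> nat \<Rightarrow> nat \<Rightarrow> real^'n^'n" where
  "backward_product G k t = fold (\<lambda>l P. G l ** P) [t..<Suc k] (mat 1)"

lemma backward_product_same: "backward_product G t t = G t"
  by (simp add: backward_product_def)

lemma backward_product_Suc:
  "t \<le> Suc k \<Longrightarrow> backward_product G (Suc k) t = G (Suc k) ** backward_product G k t"
  by (simp add: backward_product_def)

(* This predicate and the next one are meant for chains of stochastic matrices. *)
definition ergodic_chain :: "(nat \<Rightarrow> real^'n^'n) \<Rightarrow> bool" where
  "ergodic_chain G \<longleftrightarrow>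
     (\<forall>t j. \<exists>g. \<forall>i. (\<lambda>k. backward_product G k t $ i $ j) \<longlonglongrightarrow> g)"

(* The entries are nonnegative, so the sum is taken in [0, \<infinity>] without loss. *)
definition infinite_flow :: "(nat \<Rightarrow> real^'n^'n) \<Rightarrow> bool" where
  "infinite_flow G \<longleftrightarrow>
     (\<forall>S. S \<noteq> {} \<and> S \<noteq> UNIV \<longrightarrow>
        (\<Sum>k. ennreal (\<Sum>i\<in>S. \<Sum>j\<in>- S. G k $ i $ j + G k $ j $ i)) = \<infinity>)"

definition random_model :: "'w measure \<Rightarrow> (nat \<Rightarrow> 'w \<Rightarrow> real^'n^'n) \<Rightarrow> bool" where
  "random_model M W \<longleftrightarrow> prob_space M \<and>
     (\<forall>k. W k \<in> borel_measurable M) \<and>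
     (\<forall>k. \<forall>\<omega>\<in>space M. stochastic_matrix (W k \<omega>))"

definition independent_model :: "'w measure \<Rightarrow> (nat \<Rightarrow> 'w \<Rightarrow> real^'n^'n) \<Rightarrow> bool" where
  "independent_model M W \<longleftrightarrow>
     random_model M W \<and> prob_space.indep_vars M (\<lambda>_. borel) W UNIV"

definition expected_model :: "'w measure \<Rightarrow> (nat \<Rightarrow> 'w \<Rightarrow> real^'n^'n) \<Rightarrow> nat \<Rightarrow> real^'n^'n" where
  "expected_model M W k = (\<chi> i j. \<integral>\<omega>. W k \<omega> $ i $ j \<partial>M)"

definition ergodic_model :: "'w measure \<Rightarrow> (nat \<Rightarrow> 'w \<Rightarrow> real^'n^'n) \<Rightarrow> bool" where
  "ergodic_model M W \<longleftrightarrow> (AE \<omega> in M. ergodic_chain (\<lambda>k. W k \<omega>))"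

definition infinite_flow_model :: "'w measure \<Rightarrow> (nat \<Rightarrow> 'w \<Rightarrow> real^'n^'n) \<Rightarrow> bool" where
  "infinite_flow_model M W \<longleftrightarrow> (AE \<omega> in M. infinite_flow (\<lambda>k. W k \<omega>))"

definition common_steady_state ::
    "'w measure \<Rightarrow> (nat \<Rightarrow> 'w \<Rightarrow> real^'n^'n) \<Rightarrow> real^'n \<Rightarrow> bool" where
  "common_steady_state M W \<pi> \<longleftrightarrow>
     stochastic_vector \<pi> \<and> (\<forall>k. \<pi> v* expected_model M W k = \<pi>)"

definition weak_feedback :: "'w measure \<Rightarrow> (nat \<Rightarrow> 'w \<Rightarrow> real^'n^'n) \<Rightarrow> bool" where
  "weak_feedback M W \<longleftrightarrow>
     (\<exists>\<gamma>>0. \<forall>k i j. i \<noteq> j \<longrightarrow>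
        (\<integral>\<omega>. column i (W k \<omega>) \<bullet> column j (W k \<omega>) \<partial>M)
          \<ge> \<gamma> * ((\<integral>\<omega>. W k \<omega> $ i $ j \<partial>M) + (\<integral>\<omega>. W k \<omega> $ j $ i \<partial>M)))"

end

theory Submission
  imports Defs
begin

text \<open>
  Two facts about deterministic chains carry the proof. If the flow across a cut \<open>S\<close> is summable,
  the trajectory started late enough from the indicator of \<open>S\<close> stays above \<open>3/4\<close> on \<open>S\<close> and below
  \<open>1/4\<close> off \<open>S\<close>, so an ergodic chain has infinite flow. Conversely, infinite flow together with
  \<open>\<Sum>\<^sub>k \<Sum>\<^sub>i\<^sub>j (W\<^sub>i\<^sub>j(k) + W\<^sub>j\<^sub>i(k)) (x\<^sub>i(k) - x\<^sub>j(k))\<^sup>2 < \<infinity>\<close> forces consensus of the trajectory \<open>x\<close>: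
  a spread that does not vanish yields, at every time, a cut with a fixed gap, and the gap can only be
  closed by an amount of flow that costs a fixed amount of this sum. The sum is almost surely finite
  because \<open>E \<Sum>\<^sub>i \<pi>\<^sub>i x\<^sub>i\<^sup>2\<close> decreases at each step by at least a multiple of the expected summand, by
  weak feedback and independence of \<open>x(k)\<close> and \<open>W(k)\<close>. The infinite flow property passes between the
  model and its expectation since a series of independent, uniformly bounded, nonnegative variables
  diverges almost surely iff its expected sum does, and ergodicity passes to the expected model by
  dominated convergence.
\<close>

subsection \<open>Flows and trajectories of deterministic chains\<close>

text \<open>The summand of \<open>infinite_flow\<close> as a real number, so that divergence can be
  expressed through \<open>summable\<close>.\<close>

definition flow :: "'n set \<Rightarrow> real^'n^'n \<Rightarrow> real" where
  "flow S A = (\<Sum>i\<in>S. \<Sum>j\<in>- S. A $ i $ j + A $ j $ i)"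

text \<open>\<open>traj G v n\<close> involves only \<open>G 0\<close> to \<open>G (n - 1)\<close>,
  which later makes the state independent of the next matrix. Other start times are handled by
  shifting the chain.\<close>

primrec traj :: "(nat \<Rightarrow> real^'n^'n) \<Rightarrow> real^'n \<Rightarrow> nat \<Rightarrow> real^'n" where
  "traj G v 0 = v"
| "traj G v (Suc n) = G n *v traj G v n"

lemma matvec_nth: "(A *v x) $ i = (\<Sum>j\<in>UNIV. A $ i $ j * x $ j)"
  by (simp add: matrix_vector_mult_def)

lemma stochastic_matrixD:
  assumes "stochastic_matrix A"
  shows "0 \<le> A $ i $ j" "(\<Sum>j\<in>UNIV. A $ i $ j) = 1" "A $ i $ j \<le> 1"
proof -
  show *: "0 \<le> A $ i $ j" for i j
    using assms by (simp add: stochastic_matrix_def)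
  show sum: "(\<Sum>j\<in>UNIV. A $ i $ j) = 1"
    using assms by (simp add: stochastic_matrix_def)
  show "A $ i $ j \<le> 1"
    using member_le_sum[of j UNIV "\<lambda>j. A $ i $ j"] * sum by simp
qed

lemma flow_nonneg: "stochastic_matrix A \<Longrightarrow> 0 \<le> flow S A"
  unfolding flow_def by (intro sum_nonneg add_nonneg_nonneg stochastic_matrixD)

lemma flow_Compl: "flow (- S) A = flow S A"
  unfolding flow_def by (subst sum.swap) (simp add: add.commute)

lemma outflow_le_flow:
  assumes "stochastic_matrix A" "i \<in> S"
  shows "(\<Sum>j\<in>- S. A $ i $ j) \<le> flow S A"
proof -
  have "(\<Sum>j\<in>- S. A $ i $ j) \<le> (\<Sum>j\<in>- S. A $ i $ j + A $ j $ i)"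
    by (intro sum_mono) (simp add: stochastic_matrixD[OF assms(1)])
  also have "\<dots> \<le> flow S A"
    unfolding flow_def
    by (intro member_le_sum[of i S "\<lambda>i. \<Sum>j\<in>- S. A $ i $ j + A $ j $ i"] sum_nonneg add_nonneg_nonneg
        stochastic_matrixD[OF assms(1)] assms(2)) simp
  finally show ?thesis .
qed

lemma flow_le:
  fixes A :: "real^'n^'n"
  assumes "stochastic_matrix A"
  shows "flow S A \<le> 2 * real (CARD('n)) ^ 2"
proof -
  have "flow S A \<le> (\<Sum>i\<in>S. \<Sum>j\<in>- S. 2)"
    unfolding flow_def
  proof (intro sum_mono)
    fix i j show "A $ i $ j + A $ j $ i \<le> 2"
      using stochastic_matrixD(3)[OF assms, of i j] stochastic_matrixD(3)[OF assms, of j i] by simp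
  qed
  also have "\<dots> \<le> (\<Sum>i\<in>S. \<Sum>j\<in>(UNIV::'n set). 2)"
    by (intro sum_mono sum_mono2) auto
  also have "\<dots> \<le> (\<Sum>i\<in>(UNIV::'n set). \<Sum>j\<in>(UNIV::'n set). 2)"
    by (intro sum_mono2) auto
  finally show ?thesis
    by (simp add: power2_eq_square)
qed

lemma infinite_flow_iff_summable:
  assumes "\<And>k. stochastic_matrix (G k)"
  shows "infinite_flow G \<longleftrightarrow> (\<forall>S. S \<noteq> {} \<and> S \<noteq> UNIV \<longrightarrow> \<not> summable (\<lambda>k. flow S (G k)))"
proof -
  have "(\<Sum>k. ennreal (flow S (G k))) = \<infinity> \<longleftrightarrow> \<not> summable (\<lambda>k. flow S (G k))" for S
    using summable_suminf_not_top[of "\<lambda>k. flow S (G k)", OF flow_nonneg[OF assms]]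
      ennreal_suminf_neq_top[of "\<lambda>k. flow S (G k)", OF _ flow_nonneg[OF assms]]
    unfolding infinity_ennreal_def by blast
  then show ?thesis
    by (simp add: infinite_flow_def flow_def)
qed

section \<open>Averaging by stochastic matrices and trajectories\<close>

lemma stochastic_average_ge:
  assumes "stochastic_matrix A" "\<And>i. l \<le> x $ i"
  shows "l \<le> (A *v x) $ i"
proof -
  have "l = (\<Sum>j\<in>UNIV. A $ i $ j * l)"
    using stochastic_matrixD(2)[OF assms(1), of i] by (simp flip: sum_distrib_right)
  also have "\<dots> \<le> (A *v x) $ i"
    unfolding matvec_nth by (intro sum_mono mult_left_mono assms stochastic_matrixD)
  finally show ?thesis .
qed

lemma stochastic_average_le:
  assumes "stochastic_matrix A" "\<And>i. x $ i \<le> h"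
  shows "(A *v x) $ i \<le> h"
proof -
  have "(A *v x) $ i \<le> (\<Sum>j\<in>UNIV. A $ i $ j * h)"
    unfolding matvec_nth by (intro sum_mono mult_left_mono assms stochastic_matrixD)
  also have "\<dots> = h"
    using stochastic_matrixD(2)[OF assms(1), of i] by (simp flip: sum_distrib_right)
  finally show ?thesis .
qed

lemma traj_bounds:
  assumes "\<And>n. stochastic_matrix (G n)" "\<And>i. l \<le> v $ i" "\<And>i. v $ i \<le> h"
  shows "l \<le> traj G v n $ i" "traj G v n $ i \<le> h"
  using assms
  by (induction n arbitrary: i) (auto intro!: stochastic_average_ge stochastic_average_le)

lemma traj_add: "traj G v (m + n) = traj (\<lambda>k. G (m + k)) (traj G v m) n"
  by (induction n) auto

lemma traj_uminus: "traj G (- v) n = - traj G v n"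
  by (induction n) (auto simp: vec_eq_iff matvec_nth sum_negf)

lemma backward_product_traj:
  "(backward_product G (t + n) t *v v) = traj (\<lambda>k. G (t + k)) v (Suc n)"
proof (induction n)
  case 0
  then show ?case by (simp add: backward_product_same)
next
  case (Suc n)
  then show ?case
    by (simp add: backward_product_Suc flip: matrix_vector_mul_assoc)
qed

text \<open>Column \<open>j\<close> of the backward product is the trajectory started at the
  \<open>j\<close>-th basis vector.\<close>

lemma ergodic_chain_iff_traj:
  "ergodic_chain G \<longleftrightarrow>
     (\<forall>t j. \<exists>g. \<forall>i. (\<lambda>n. traj (\<lambda>k. G (t + k)) (axis j 1) n $ i) \<longlonglongrightarrow> g)"
proof -
  have "(\<lambda>k. backward_product G k t $ i $ j) \<longlonglongrightarrow> g \<longleftrightarrow>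
      (\<lambda>n. traj (\<lambda>k. G (t + k)) (axis j 1) n $ i) \<longlonglongrightarrow> g" for t i j g
  proof -
    \<comment> \<open>The product over the times \<open>t\<close> to \<open>n + t\<close> has
      \<open>n + 1\<close> factors, hence \<open>Suc n\<close>.\<close>
    have *: "backward_product G (n + t) t $ i $ j = traj (\<lambda>k. G (t + k)) (axis j 1) (Suc n) $ i" for n
      unfolding backward_product_traj[symmetric]
      by (simp add: matrix_vector_mul_component inner_axis add.commute)
    have "(\<lambda>k. backward_product G k t $ i $ j) \<longlonglongrightarrow> g \<longleftrightarrow>
        (\<lambda>n. backward_product G (n + t) t $ i $ j) \<longlonglongrightarrow> g"
      by (rule iffI[OF LIMSEQ_ignore_initial_segment LIMSEQ_offset[where k=t]])
    then show ?thesis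
      unfolding * filterlim_sequentially_Suc[of "\<lambda>n. traj (\<lambda>k. G (t + k)) (axis j 1) n $ i"] .
  qed
  then show ?thesis
    by (simp add: ergodic_chain_def)
qed

subsection \<open>Cuts with a gap\<close>

text \<open>The weight that a row in \<open>S\<close> puts outside \<open>S\<close> is at most the
  flow, and entries there are still at least \<open>l\<close>. So the floor \<open>a\<close> on
  \<open>S\<close> sinks in each step by at most \<open>D\<close> times the flow. Leaving
  \<open>D\<close> free lets both sides of a cut use the same constant.\<close>

lemma drift_le_flow:
  assumes st: "\<And>n. stochastic_matrix (G n)"
    and a: "\<And>i. i \<in> S \<Longrightarrow> a \<le> v $ i" and bd: "\<And>i. l \<le> v $ i" and ah: "a - l \<le> D" and D: "0 \<le> D"
    and i: "i \<in> S"
  shows "a - D * (\<Sum>k<n. flow S (G k)) \<le> traj G v n $ i"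
  using i
proof (induction n arbitrary: i)
  case 0
  then show ?case using a by simp
next
  case (Suc n)
  define c where "c = a - D * (\<Sum>k<n. flow S (G k))"
  define out where "out = (\<Sum>j\<in>- S. G n $ i $ j)"
  let ?x = "traj G v n"
  have lx: "l \<le> ?x $ j" for j
  proof (induction n arbitrary: j)
    case 0
    then show ?case using bd by simp
  next
    case (Suc n)
    then show ?case by (simp add: stochastic_average_ge st)
  qed
  have out: "0 \<le> out" "out \<le> flow S (G n)"
    unfolding out_def
    using outflow_le_flow[OF st Suc.prems] by (auto intro: sum_nonneg stochastic_matrixD[OF st])
  \<comment> \<open>The current floor \<open>c\<close> is at most \<open>a\<close>, so a unit of
    outgoing weight still costs at most \<open>D\<close>.\<close>
  have "c \<le> a"
    unfolding c_def using D flow_nonneg[OF st] by (simp add: sum_nonneg)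
  then have "out * (c - l) \<le> out * D"
    using ah out by (intro mult_left_mono) auto
  also have "\<dots> \<le> flow S (G n) * D"
    using out D by (intro mult_right_mono) auto
  finally have loss: "out * (c - l) \<le> D * flow S (G n)"
    by (simp add: mult.commute)
  have "(\<Sum>j\<in>UNIV. G n $ i $ j) = (\<Sum>j\<in>S. G n $ i $ j) + out"
    unfolding out_def by (subst sum.union_disjoint[symmetric]) (auto simp: Compl_partition)
  then have "(\<Sum>j\<in>S. G n $ i $ j) = 1 - out"
    by (simp add: stochastic_matrixD[OF st])
  \<comment> \<open>The new entry averages values of at least \<open>c\<close> with weight
    \<open>1 - out\<close> and values of at least \<open>l\<close> with weight
    \<open>out\<close>.\<close>
  then have "c - out * (c - l) = (\<Sum>j\<in>S. G n $ i $ j) * c + out * l"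
    by (simp only: left_diff_distrib right_diff_distrib mult_1_left)
  also have "\<dots> = (\<Sum>j\<in>S. G n $ i $ j * c) + (\<Sum>j\<in>- S. G n $ i $ j * l)"
    by (simp only: out_def sum_distrib_right)
  also have "\<dots> \<le> (\<Sum>j\<in>S. G n $ i $ j * ?x $ j) + (\<Sum>j\<in>- S. G n $ i $ j * ?x $ j)"
    using Suc.IH lx
    by (intro add_mono sum_mono mult_left_mono stochastic_matrixD[OF st]) (auto simp: c_def)
  also have "\<dots> = (\<Sum>j\<in>UNIV. G n $ i $ j * ?x $ j)"
    by (subst sum.union_disjoint[symmetric]) (auto simp: Compl_partition)
  finally have "c - D * flow S (G n) \<le> (G n *v ?x) $ i"
    using loss unfolding matvec_nth by linarith
  then show ?case
    by (simp add: c_def ring_distribs)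
qed

text \<open>The floor on \<open>S\<close> and the ceiling off \<open>S\<close> each erode by at most
  \<open>h - l\<close> times the flow, which is the same for \<open>S\<close> and
  \<open>- S\<close>; this gives the factor 2.\<close>

lemma gap_persists:
  assumes st: "\<And>n. stochastic_matrix (G n)"
    and S: "S \<noteq> {}" "S \<noteq> UNIV"
    and ab: "\<And>i. i \<in> S \<Longrightarrow> a \<le> v $ i" "\<And>i. i \<notin> S \<Longrightarrow> v $ i \<le> b"
    and bd: "\<And>i. l \<le> v $ i" "\<And>i. v $ i \<le> h"
    and ij: "i \<in> S" "j \<notin> S"
  shows "a - b - 2 * (h - l) * (\<Sum>k<n. flow S (G k)) \<le> traj G v n $ i - traj G v n $ j"
proof -
  have "l \<le> h" "a \<le> h" "l \<le> b"
    using bd(1)[of i] bd(2)[of i] ab(1)[OF ij(1)] ab(2)[OF ij(2)] bd(1)[of j] by auto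
  then have "a - (h - l) * (\<Sum>k<n. flow S (G k)) \<le> traj G v n $ i"
    by (intro drift_le_flow[where l=l] st ab bd ij) auto
  \<comment> \<open>The ceiling off \<open>S\<close> is a floor of the mirrored trajectory on
    \<open>- S\<close>, with \<open>- b\<close> and \<open>- h\<close> in place of \<open>a\<close>
    and \<open>l\<close>.\<close>
  moreover have "- b - (h - l) * (\<Sum>k<n. flow (- S) (G k)) \<le> traj G (- v) n $ j"
    using \<open>l \<le> h\<close> \<open>l \<le> b\<close> ij
    by (intro drift_le_flow[where l="- h"] st) (auto intro: ab bd)
  moreover have "2 * (h - l) * f = (h - l) * f + (h - l) * f" for f
    by simp
  ultimately show ?thesis
    unfolding flow_Compl traj_uminus vector_uminus_component by linarith
qed

section \<open>Ergodic chains have infinite flow\<close>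

theorem ergodic_imp_infinite_flow:
  assumes st: "\<And>k. stochastic_matrix (G k)" and erg: "ergodic_chain G"
  shows "infinite_flow G"
proof (rule ccontr)
  assume "\<not> infinite_flow G"
  then obtain S where S: "S \<noteq> {}" "S \<noteq> UNIV" and sm: "summable (\<lambda>k. flow S (G k))"
    using infinite_flow_iff_summable[OF st] by auto
  obtain i j where ij: "i \<in> S" "j \<notin> S"
    using S by auto
  \<comment> \<open>The indicator below takes values in \<open>[0, 1]\<close>, so a remaining flow
    of \<open>1 / 4\<close> closes at most \<open>1 / 2\<close> of its unit gap.\<close>
  obtain t where t: "norm (\<Sum>k. flow S (G (k + t))) < 1 / 4"
    using suminf_exist_split[OF _ sm, of "1/4"] by auto
  define H where "H = (\<lambda>k. G (t + k))"
  have sH: "summable (\<lambda>k. flow S (H k))"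
    unfolding H_def using sm summable_iff_shift[of "\<lambda>k. flow S (G k)" t] by (simp add: add.commute)
  have small: "(\<Sum>k<n. flow S (H k)) \<le> 1 / 4" for n
  proof -
    have "(\<Sum>k<n. flow S (H k)) \<le> (\<Sum>k. flow S (H k))"
      by (intro sum_le_suminf sH) (auto simp: H_def flow_nonneg st)
    then show ?thesis
      using t by (simp add: H_def add.commute)
  qed
  \<comment> \<open>The indicator of \<open>S\<close>, written as a sum of basis vectors so that
    linearity transfers the limits supplied by ergodicity.\<close>
  define v :: "real^'a" where "v = (\<Sum>l\<in>S. axis l 1)"
  have v: "v $ l = (if l \<in> S then 1 else 0)" for l
    by (simp add: v_def axis_def if_distrib sum.delta cong: if_cong)
  have gap: "1 / 2 \<le> traj H v n $ i - traj H v n $ j" for n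
  proof -
    have "1 - 0 - 2 * (1 - 0) * (\<Sum>k<n. flow S (H k)) \<le> traj H v n $ i - traj H v n $ j"
      by (rule gap_persists[OF _ S]) (auto simp: H_def st v ij)
    then show ?thesis
      using small[of n] by simp
  qed
  have "\<forall>l. \<exists>g. \<forall>i. (\<lambda>n. traj H (axis l 1) n $ i) \<longlonglongrightarrow> g"
    using erg by (simp add: ergodic_chain_iff_traj H_def)
  then obtain g where g: "\<And>l i. (\<lambda>n. traj H (axis l 1) n $ i) \<longlonglongrightarrow> g l"
    by metis
  have lin: "traj H v n = (\<Sum>l\<in>S. traj H (axis l 1) n)" for n
    by (induction n) (simp_all add: v_def linear_sum[OF matrix_vector_mul_linear])
  have "(\<lambda>n. traj H v n $ i) \<longlonglongrightarrow> (\<Sum>l\<in>S. g l)" for i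
    unfolding lin sum_component by (intro tendsto_sum g)
  then have "(\<lambda>n. traj H v n $ i - traj H v n $ j) \<longlonglongrightarrow> (\<Sum>l\<in>S. g l) - (\<Sum>l\<in>S. g l)"
    by (intro tendsto_diff)
  then have "1 / 2 \<le> (\<Sum>l\<in>S. g l) - (\<Sum>l\<in>S. g l)"
    by (rule LIMSEQ_le_const) (use gap in auto)
  then show False by simp
qed

text \<open>Pigeonhole: the \<open>CARD('n)\<close> disjoint intervals of length \<open>\<delta>\<close> to the right of \<open>x $ p\<close>
  cannot all be hit by the remaining \<open>CARD('n) - 1\<close> coordinates.\<close>

lemma exists_gap:
  fixes x :: "real^'n"
  assumes sp: "real (CARD('n)) * \<delta> \<le> x $ q - x $ p" and d: "0 < \<delta>"
  obtains S a where "S \<noteq> {}" "S \<noteq> UNIV" "\<And>i. i \<in> S \<Longrightarrow> a + \<delta> \<le> x $ i" "\<And>i. i \<notin> S \<Longrightarrow> x $ i \<le> a"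
proof -
  let ?m = "CARD('n)"
  let ?P = "\<lambda>k i. x $ p + real k * \<delta> < x $ i \<and> x $ i < x $ p + (real k + 1) * \<delta>"
  have "\<exists>k<?m. \<forall>i. \<not> ?P k i"
  proof (rule ccontr)
    assume "\<not> ?thesis"
    then have "\<forall>k. \<exists>i. k < ?m \<longrightarrow> ?P k i" by auto
    then obtain f where f: "\<And>k. k < ?m \<Longrightarrow> ?P k (f k)"
      by metis
    have less: False if "k < k'" "k' < ?m" "f k = f k'" for k k'
    proof -
      have "(real k + 1) * \<delta> \<le> real k' * \<delta>"
        using that d by (intro mult_right_mono) auto
      then show False
        using f[of k] f[of k'] that by auto
    qed
    have "inj_on f {..<?m}"
    proof (rule inj_onI)
      fix k k' assume "k \<in> {..<?m}" "k' \<in> {..<?m}" "f k = f k'"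
      then show "k = k'"
        using less[of k k'] less[of k' k] by (cases k k' rule: linorder_cases) auto
    qed
    then have "card (f ` {..<?m}) = ?m"
      by (simp add: card_image)
    moreover have "f ` {..<?m} \<subseteq> UNIV - {p}"
    proof safe
      fix k assume "k < ?m" "p = f k"
      then have "real k * \<delta> < 0" using f[of k] by auto
      then show False using d by (simp add: mult_less_0_iff)
    qed simp
    ultimately have "?m \<le> card (UNIV - {p})"
      by (metis card_mono finite)
    moreover have "card (UNIV - {p}) < ?m"
      by (rule psubset_card_mono) auto
    ultimately show False
      by (metis leD)
  qed
  then obtain k where k: "k < ?m" "\<And>i. \<not> ?P k i" by auto
  \<comment> \<open>Interval \<open>k\<close> ends no later than \<open>x $ q\<close>, so
    \<open>q\<close> lies above its left end.\<close>
  have "(real k + 1) * \<delta> \<le> real ?m * \<delta>"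
    using k(1) d by (intro mult_right_mono) auto
  then have q: "x $ p + real k * \<delta> < x $ q"
    using sp d by (simp add: algebra_simps)
  show ?thesis
  \<comment> \<open>The cut is made at the left end of the empty interval: an entry beyond it must
    clear the whole length \<delta>.\<close>
  proof (rule that[of "{i. x $ p + real k * \<delta> < x $ i}" "x $ p + real k * \<delta>"])
    show "{i. x $ p + real k * \<delta> < x $ i} \<noteq> {}"
      using q by auto
    have "p \<notin> {i. x $ p + real k * \<delta> < x $ i}"
      using d by (simp add: mult_less_0_iff)
    then show "{i. x $ p + real k * \<delta> < x $ i} \<noteq> UNIV"
      by blast
    show "x $ p + real k * \<delta> + \<delta> \<le> x $ i" if "i \<in> {i. x $ p + real k * \<delta> < x $ i}" for i
      using k(2)[of i] that by (simp add: algebra_simps)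
    show "x $ i \<le> x $ p + real k * \<delta>" if "i \<notin> {i. x $ p + real k * \<delta> < x $ i}" for i
      using that by simp
  qed
qed

subsection \<open>Infinite flow and finite dissipation force consensus\<close>

definition dissipation :: "real^'n^'n \<Rightarrow> real^'n \<Rightarrow> real" where
  "dissipation A x = (\<Sum>i\<in>UNIV. \<Sum>j\<in>UNIV. (A $ i $ j + A $ j $ i) * (x $ i - x $ j)\<^sup>2)"

lemma dissipation_nonneg: "stochastic_matrix A \<Longrightarrow> 0 \<le> dissipation A x"
  unfolding dissipation_def
  by (intro sum_nonneg mult_nonneg_nonneg add_nonneg_nonneg stochastic_matrixD) auto

text \<open>All summands are nonnegative, and those across the cut alone already give the
  bound.\<close>

lemma dissipation_ge_flow:
  assumes st: "stochastic_matrix A" and c: "0 \<le> c"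
    and gap: "\<And>i j. i \<in> S \<Longrightarrow> j \<notin> S \<Longrightarrow> c \<le> x $ i - x $ j"
  shows "c\<^sup>2 * flow S A \<le> dissipation A x"
proof -
  let ?f = "\<lambda>i j. (A $ i $ j + A $ j $ i) * (x $ i - x $ j)\<^sup>2"
  have nn: "0 \<le> ?f i j" for i j
    by (intro mult_nonneg_nonneg add_nonneg_nonneg stochastic_matrixD[OF st]) auto
  have "c\<^sup>2 * flow S A = (\<Sum>i\<in>S. \<Sum>j\<in>- S. (A $ i $ j + A $ j $ i) * c\<^sup>2)"
    by (simp add: flow_def sum_distrib_left mult.commute)
  also have "\<dots> \<le> (\<Sum>i\<in>S. \<Sum>j\<in>- S. ?f i j)"
    using gap c
    by (intro sum_mono mult_left_mono power_mono add_nonneg_nonneg stochastic_matrixD[OF st]) auto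
  also have "\<dots> \<le> (\<Sum>i\<in>S. \<Sum>j\<in>UNIV. ?f i j)"
    by (intro sum_mono sum_mono2 nn) auto
  also have "\<dots> \<le> dissipation A x"
    unfolding dissipation_def by (intro sum_mono2 sum_nonneg nn) auto
  finally show ?thesis .
qed

text \<open>As long as the flow across a cut with a gap has not used up the gap, dissipation is at least
  proportional to that flow; so little dissipation bounds the total flow.\<close>

lemma dissipation_lower_bound:
  fixes v :: "real^'n"
  assumes st: "\<And>n. stochastic_matrix (G n)"
    and inf: "\<And>S. S \<noteq> {} \<Longrightarrow> S \<noteq> UNIV \<Longrightarrow> \<not> summable (\<lambda>k. flow S (G k))"
    and bd: "\<And>i. l \<le> v $ i" "\<And>i. v $ i \<le> h"
    and spread: "real (CARD('n)) * \<delta> \<le> v $ q - v $ p" and d: "0 < \<delta>"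
    and bound: "\<And>n. (\<Sum>k<n. dissipation (G k) (traj G v k)) \<le> B"
  shows "\<delta> ^ 3 \<le> 16 * (h - l) * B"
proof (rule ccontr)
  assume neg: "\<not> ?thesis"
  obtain S a where S: "S \<noteq> {}" "S \<noteq> UNIV"
    and gap: "\<And>i. i \<in> S \<Longrightarrow> a + \<delta> \<le> v $ i" "\<And>i. i \<notin> S \<Longrightarrow> v $ i \<le> a"
    using exists_gap[OF spread d] by metis
  have "0 < real (CARD('n)) * \<delta>"
    using d by simp
  then have D: "0 < h - l"
    using spread bd(1)[of p] bd(2)[of q] by linarith
  let ?F = "\<lambda>n. \<Sum>k<n. flow S (G k)"
  \<comment> \<open>At most half of the gap is ever lost: if this holds before \<open>n\<close>, a
    gap of \<open>\<delta> / 2\<close> turns the dissipation bound into a flow bound at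
    \<open>n\<close>. The 16 is the 4 from squaring \<open>\<delta> / 2\<close> times the 4
    here.\<close>
  have F: "4 * (h - l) * ?F n < \<delta>" for n
  proof (induction n rule: less_induct)
    case (less n)
    have gap': "\<delta> / 2 \<le> traj G v k $ i - traj G v k $ j" if "k < n" "i \<in> S" "j \<notin> S" for i j k
    proof -
      have "(a + \<delta>) - a - 2 * (h - l) * ?F k \<le> traj G v k $ i - traj G v k $ j"
        by (rule gap_persists[OF st S gap bd that(2,3)])
      moreover have "4 * (h - l) * f = 2 * (2 * (h - l) * f)" for f
        by simp
      ultimately show ?thesis
        using less[OF that(1)] by linarith
    qed
    have "(\<delta> / 2)\<^sup>2 * ?F n \<le> (\<Sum>k<n. dissipation (G k) (traj G v k))"
      unfolding sum_distrib_left
      using gap' d by (intro sum_mono dissipation_ge_flow st) auto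
    also note bound
    finally have "\<delta>\<^sup>2 * ?F n \<le> 4 * B"
      by (simp add: power_divide)
    then have "4 * (h - l) * (\<delta>\<^sup>2 * ?F n) \<le> 4 * (h - l) * (4 * B)"
      using D by (intro mult_left_mono) auto
    also have "\<dots> < \<delta>\<^sup>2 * \<delta>"
      using neg by (simp add: power3_eq_cube power2_eq_square left_diff_distrib not_le)
    finally have "\<delta>\<^sup>2 * (4 * (h - l) * ?F n) < \<delta>\<^sup>2 * \<delta>"
      by (simp add: mult_ac)
    then show ?case
      using d by simp
  qed
  have "summable (\<lambda>k. flow S (G k))"
  proof (rule summableI_nonneg_bounded)
    show "0 \<le> flow S (G k)" for k by (rule flow_nonneg[OF st])
    show "?F n \<le> \<delta> / (4 * (h - l))" for n
      using F[of n] D by (simp add: field_simps)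
  qed
  with inf[OF S] show False by simp
qed

text \<open>Once the remaining dissipation falls below the threshold of
  \<open>dissipation_lower_bound\<close>, the spread must be small; it stays small because averages
  never leave the range of the current entries.\<close>

theorem consensus_if_dissipation_summable:
  fixes v :: "real^'n"
  assumes st: "\<And>n. stochastic_matrix (G n)"
    and inf: "\<And>S. S \<noteq> {} \<Longrightarrow> S \<noteq> UNIV \<Longrightarrow> \<not> summable (\<lambda>k. flow S (G k))"
    and sm: "summable (\<lambda>n. dissipation (G n) (traj G v n))"
  shows "\<exists>g. \<forall>i. (\<lambda>n. traj G v n $ i) \<longlonglongrightarrow> g"
proof -
  \<comment> \<open>Adding 1 keeps \<open>h - l\<close> positive even when \<open>v\<close> is
    constant.\<close>
  define l h where "l = Min (range (($) v))" and "h = Max (range (($) v)) + 1"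
  have "v $ i \<le> Max (range (($) v))" for i
    by (rule Max_ge) auto
  then have bd: "l \<le> v $ i" "v $ i < h" for i
    by (auto simp: l_def h_def add_strict_increasing2 intro: le_less_trans[OF _ less_add_one])
  then have bd': "l \<le> v $ i" "v $ i \<le> h" for i
    by (auto intro: less_imp_le)
  \<comment> \<open>\<open>undefined\<close> serves as an arbitrary index, here and below.\<close>
  have D: "0 < h - l"
    using bd[of undefined] by simp
  let ?x = "traj G v"
  have close: "\<exists>T. \<forall>i j. ?x T $ i - ?x T $ j < e" if e: "0 < e" for e
  proof -
    \<comment> \<open>Chosen so that a spread of \<open>e\<close> forces a cut with gap
      \<delta>.\<close>
    define \<delta> where "\<delta> = e / real (CARD('n))"
    have d: "0 < \<delta>" "real (CARD('n)) * \<delta> = e"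
      using e by (auto simp: \<delta>_def)
    obtain T where T: "norm (\<Sum>k. dissipation (G (k + T)) (?x (k + T))) < \<delta> ^ 3 / (16 * (h - l))"
      using suminf_exist_split[OF _ sm, of "\<delta> ^ 3 / (16 * (h - l))"] d D by auto
    define H where "H k = G (T + k)" for k
    define B where "B = (\<Sum>k. dissipation (H k) (traj H (?x T) k))"
    have HT: "traj H (?x T) k = ?x (T + k)" for k
      unfolding traj_add H_def ..
    have sH: "summable (\<lambda>k. dissipation (H k) (traj H (?x T) k))"
      unfolding HT H_def using sm
        summable_iff_shift[of "\<lambda>n. dissipation (G n) (traj G v n)" T] by (simp add: add.commute)
    have stH: "stochastic_matrix (H k)" for k
      by (simp add: H_def st)
    have "B < \<delta> ^ 3 / (16 * (h - l))"
      using T by (simp add: B_def HT H_def add.commute)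
    then have B: "16 * (h - l) * B < \<delta> ^ 3"
      using D by (simp add: field_simps)
    show ?thesis
    proof (rule ccontr)
      assume "\<not> ?thesis"
      then obtain q p where "e \<le> ?x T $ q - ?x T $ p"
        by (meson not_less)
      then have sp: "real (CARD('n)) * \<delta> \<le> ?x T $ q - ?x T $ p"
        using d by simp
      have "\<delta> ^ 3 \<le> 16 * (h - l) * B"
      proof (rule dissipation_lower_bound[OF stH _ _ _ sp d(1)])
        show "\<not> summable (\<lambda>k. flow S (H k))" if "S \<noteq> {}" "S \<noteq> UNIV" for S
          using inf[OF that] summable_iff_shift[of "\<lambda>k. flow S (G k)" T]
          by (simp add: H_def add.commute)
        show "l \<le> ?x T $ i" "?x T $ i \<le> h" for i
          by (rule traj_bounds[OF st bd'])+
        show "(\<Sum>k<n. dissipation (H k) (traj H (?x T) k)) \<le> B" for n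
          unfolding B_def by (intro sum_le_suminf sH) (auto simp: dissipation_nonneg stH)
      qed
      with B show False by simp
    qed
  qed
  have late: "\<exists>T. \<forall>m\<ge>T. \<forall>n\<ge>T. \<forall>i j. \<bar>?x m $ i - ?x n $ j\<bar> < e" if e: "0 < e" for e
  proof -
    obtain T where T: "\<And>i j. ?x T $ i - ?x T $ j < e / 3"
      using close[of "e / 3"] e by auto
    \<comment> \<open>From time \<open>T\<close> on all entries stay within \<open>e / 3\<close> of
      one reference value, so any two differ by at most \<open>2 * e / 3\<close>.\<close>
    have near: "?x T $ undefined - e / 3 \<le> ?x n $ i \<and> ?x n $ i \<le> ?x T $ undefined + e / 3"
      if n: "n \<ge> T" for n i
    proof -
      have "?x n = traj (\<lambda>k. G (T + k)) (?x T) (n - T)"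
        using n traj_add[of G v T "n - T"] by simp
      moreover have "?x T $ undefined - e / 3 \<le> ?x T $ i" "?x T $ i \<le> ?x T $ undefined + e / 3" for i
        using T[of undefined i] T[of i undefined] by auto
      ultimately show ?thesis
        using traj_bounds[of "\<lambda>k. G (T + k)"] st by metis
    qed
    have "\<bar>?x m $ i - ?x n $ j\<bar> < e" if "m \<ge> T" "n \<ge> T" for m n i j
      using near[OF that(1), of i] near[OF that(2), of j] e by linarith
    then show ?thesis by blast
  qed
  have "Cauchy (\<lambda>n. ?x n $ undefined)"
    unfolding Cauchy_def dist_real_def using late by meson
  then obtain g where g: "(\<lambda>n. ?x n $ undefined) \<longlonglongrightarrow> g"
    using Cauchy_convergent_iff convergent_def by blast
  have "(\<lambda>n. ?x n $ i) \<longlonglongrightarrow> g" for i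
  proof -
    have "(\<lambda>n. ?x n $ i - ?x n $ undefined) \<longlonglongrightarrow> 0"
      unfolding LIMSEQ_def dist_real_def using late by (metis diff_zero)
    from tendsto_add[OF this g] show ?thesis by simp
  qed
  then show ?thesis by blast
qed

subsection \<open>Sums of nonnegative random variables\<close>

text \<open>By Tonelli the series has finite expectation in \<open>ennreal\<close>, hence is finite
  almost surely.\<close>

lemma AE_summable_if_expectation_summable:
  fixes f :: "nat \<Rightarrow> 'a \<Rightarrow> real"
  assumes int: "\<And>k. integrable M (f k)"
    and nn: "\<And>k \<omega>. \<omega> \<in> space M \<Longrightarrow> 0 \<le> f k \<omega>"
    and sm: "summable (\<lambda>k. \<integral>\<omega>. f k \<omega> \<partial>M)"
  shows "AE \<omega> in M. summable (\<lambda>k. f k \<omega>)"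
proof -
  have [measurable]: "f k \<in> borel_measurable M" for k
    using int by (rule borel_measurable_integrable)
  have "(\<integral>\<^sup>+ \<omega>. (\<Sum>k. ennreal (f k \<omega>)) \<partial>M) = (\<Sum>k. \<integral>\<^sup>+ \<omega>. ennreal (f k \<omega>) \<partial>M)"
    by (rule nn_integral_suminf) measurable
  also have "\<dots> = (\<Sum>k. ennreal (\<integral>\<omega>. f k \<omega> \<partial>M))"
    by (intro suminf_cong nn_integral_eq_integral int AE_I2 nn)
  also have "\<dots> \<noteq> \<infinity>"
    unfolding infinity_ennreal_def
    by (intro ennreal_suminf_neq_top sm integral_nonneg_AE AE_I2 nn)
  finally have "AE \<omega> in M. (\<Sum>k. ennreal (f k \<omega>)) \<noteq> \<infinity>"
    by (intro nn_integral_PInf_AE) measurable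
  with AE_space show ?thesis
  proof eventually_elim
    case (elim \<omega>)
    then show ?case
      unfolding infinity_ennreal_def by (intro summable_suminf_not_top[of "\<lambda>k. f k \<omega>"] nn)
  qed
qed

text \<open>Equivalent to \<open>1 \<le> exp x * (1 - x / 2)\<close>, which follows from
  \<open>1 + x \<le> exp x\<close>.\<close>

lemma exp_minus_le_half:
  fixes x :: real
  assumes "0 \<le> x" "x \<le> 1"
  shows "exp (- x) \<le> 1 - x / 2"
proof -
  have "x * x \<le> x"
    using assms by (simp add: mult_left_le)
  then have "1 \<le> (1 + x) * (1 - x / 2)"
    by (simp add: algebra_simps)
  also have "\<dots> \<le> exp x * (1 - x / 2)"
    using assms exp_ge_add_one_self[of x] by (intro mult_right_mono) auto
  finally have "exp (- x) * 1 \<le> exp (- x) * (exp x * (1 - x / 2))"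
    by (intro mult_left_mono) auto
  then show ?thesis
    by (simp add: mult.assoc[symmetric] flip: exp_add)
qed

text \<open>A Laplace transform argument. By independence the expectation of \<open>exp\<close> of
  minus the partial sum factorizes and tends to 0. These exponentials decrease pointwise, so their
  limit is 0 almost surely, which excludes convergence of the series.\<close>

lemma (in prob_space) AE_not_summable_if_indep:
  fixes X :: "nat \<Rightarrow> 'a \<Rightarrow> real"
  assumes ind: "indep_vars (\<lambda>_. borel) X UNIV"
    and X01: "\<And>k \<omega>. \<omega> \<in> space M \<Longrightarrow> 0 \<le> X k \<omega>" "\<And>k \<omega>. \<omega> \<in> space M \<Longrightarrow> X k \<omega> \<le> 1"
    and ns: "\<not> summable (\<lambda>k. expectation (X k))"
  shows "AE \<omega> in M. \<not> summable (\<lambda>k. X k \<omega>)"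
proof -
  have [measurable]: "X k \<in> borel_measurable M" for k
    using ind by (simp add: indep_vars_def)
  have intX: "integrable M (X k)" for k
    using X01 by (intro integrable_const_bound[where B=1] AE_I2) auto
  have inte: "integrable M (\<lambda>\<omega>. exp (- X k \<omega>))" for k
    using X01 by (intro integrable_const_bound[where B=1] AE_I2) auto
  have EX: "0 \<le> expectation (X k)" for k
    using X01 by (intro integral_nonneg_AE AE_I2) auto
  \<comment> \<open>The product form serves independence, the form in \<open>Z_exp\<close>
    monotonicity and limits.\<close>
  define Z where "Z n \<omega> = (\<Prod>k<n. exp (- X k \<omega>))" for n \<omega>
  have Z_exp: "Z n \<omega> = exp (- (\<Sum>k<n. X k \<omega>))" for n \<omega>
    by (simp only: Z_def sum_negf[symmetric] exp_sum finite_lessThan)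
  define f where "f \<omega> = lim (\<lambda>n. Z n \<omega>)" for \<omega>
  have [measurable]: "Z n \<in> borel_measurable M" for n
    unfolding Z_def by measurable
  have [measurable]: "f \<in> borel_measurable M"
    unfolding f_def by measurable
  have dec: "decseq (\<lambda>n. Z n \<omega>)" if "\<omega> \<in> space M" for \<omega>
    using X01(1)[OF that] by (intro decseq_SucI) (simp add: Z_exp)
  have lim: "(\<lambda>n. Z n \<omega>) \<longlonglongrightarrow> f \<omega>" if "\<omega> \<in> space M" for \<omega>
  proof -
    have "\<forall>n. 0 \<le> Z n \<omega>"
      by (simp add: Z_exp)
    from decseq_convergent[OF dec[OF that] this]
    obtain L where "(\<lambda>n. Z n \<omega>) \<longlonglongrightarrow> L" .
    then show ?thesis
      unfolding f_def by (simp add: limI)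
  qed
  have f0: "0 \<le> f \<omega>" and fZ: "f \<omega> \<le> Z n \<omega>" if "\<omega> \<in> space M" for \<omega> n
  proof -
    show "0 \<le> f \<omega>"
      by (rule LIMSEQ_le_const[OF lim[OF that]]) (simp add: Z_exp)
    show "f \<omega> \<le> Z n \<omega>"
      by (rule decseq_ge[OF dec[OF that] lim[OF that]])
  qed
  have Z1: "Z n \<omega> \<le> 1" if "\<omega> \<in> space M" for n \<omega>
    using X01(1)[OF that] by (simp add: Z_exp sum_nonneg)
  have intZ: "integrable M (Z n)" for n
    using Z1 by (intro integrable_const_bound[where B=1] AE_I2) (auto simp: Z_exp)
  have intf: "integrable M f"
    using f0 fZ[of _ 0] by (intro integrable_const_bound[where B=1] AE_I2) (auto simp: Z_def)
  have EZ: "expectation (Z n) \<le> exp (- (\<Sum>k<n. expectation (X k)) / 2)" for n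
  proof -
    have "indep_vars (\<lambda>_. borel) (\<lambda>k \<omega>. exp (- X k \<omega>)) {..<n}"
      by (rule indep_vars_compose2[OF indep_vars_subset[OF ind]]) auto
    then have "expectation (Z n) = (\<Prod>k<n. expectation (\<lambda>\<omega>. exp (- X k \<omega>)))"
      unfolding Z_def by (intro indep_vars_lebesgue_integral inte) auto
    also have "\<dots> \<le> (\<Prod>k<n. exp (- (expectation (X k)) / 2))"
    proof (intro prod_mono conjI)
      fix k
      \<comment> \<open>Linearizing \<open>exp\<close> lets the expectation pass to
        \<open>X k\<close>; \<open>1 + y \<le> exp y\<close> then restores an exponential.\<close>
      have "expectation (\<lambda>\<omega>. exp (- X k \<omega>)) \<le> expectation (\<lambda>\<omega>. 1 - X k \<omega> / 2)"
        using X01 by (intro integral_mono inte Bochner_Integration.integrable_diff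
            Bochner_Integration.integrable_divide intX exp_minus_le_half) auto
      also have "\<dots> = 1 + (- (expectation (X k)) / 2)"
        using intX by (simp add: prob_space)
      also have "\<dots> \<le> exp (- (expectation (X k)) / 2)"
        by (rule exp_ge_add_one_self)
      finally show "expectation (\<lambda>\<omega>. exp (- X k \<omega>)) \<le> exp (- (expectation (X k)) / 2)" .
    qed (auto intro: integral_nonneg_AE)
    also have "\<dots> = exp (- (\<Sum>k<n. expectation (X k)) / 2)"
      by (simp only: sum_negf[symmetric] sum_divide_distrib exp_sum finite_lessThan)
    finally show ?thesis .
  qed
  have "expectation f = 0"
  proof (rule ccontr)
    assume "expectation f \<noteq> 0"
    moreover have "0 \<le> expectation f"
      using f0 by (intro integral_nonneg_AE AE_I2)
    ultimately have pos: "0 < expectation f" by simp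
    \<comment> \<open>Taking logarithms, a positive limit would bound the partial sums of a
      divergent series.\<close>
    have "(\<Sum>k<n. expectation (X k)) \<le> - 2 * ln (expectation f)" for n
    proof -
      have "expectation f \<le> expectation (Z n)"
        using fZ by (intro integral_mono intf intZ)
      also note EZ
      finally have "ln (expectation f) \<le> - (\<Sum>k<n. expectation (X k)) / 2"
        using pos ln_le_cancel_iff[OF pos exp_gt_zero] by (simp only: ln_exp)
      then show ?thesis by simp
    qed
    then have "summable (\<lambda>k. expectation (X k))"
      using EX by (intro summableI_nonneg_bounded)
    with ns show False by simp
  qed
  then have "AE \<omega> in M. f \<omega> = 0"
    using integral_nonneg_eq_0_iff_AE[OF intf] f0 by auto
  with AE_space show ?thesis
  proof eventually_elim
    fix \<omega> assume \<omega>: "\<omega> \<in> space M" "f \<omega> = 0"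
    show "\<not> summable (\<lambda>k. X k \<omega>)"
    proof
      assume "summable (\<lambda>k. X k \<omega>)"
      then have "(\<lambda>n. Z n \<omega>) \<longlonglongrightarrow> exp (- (\<Sum>k. X k \<omega>))"
        unfolding Z_exp by (intro tendsto_exp tendsto_minus summable_LIMSEQ)
      then have "exp (- (\<Sum>k. X k \<omega>)) = 0"
        using lim[OF \<omega>(1)] \<omega>(2) LIMSEQ_unique by metis
      then show False by simp
    qed
  qed
qed

subsection \<open>Independent random chains\<close>

lemma borel_measurable_vecI:
  fixes f :: "'a \<Rightarrow> real^'n"
  assumes "\<And>i. (\<lambda>\<omega>. f \<omega> $ i) \<in> borel_measurable M"
  shows "f \<in> borel_measurable M"
  using assms by (subst borel_measurable_euclidean_space) (auto simp: Basis_vec_def inner_axis)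

lemma borel_measurable_vec_nth [measurable]:
  "(\<lambda>x :: 'b::real_normed_vector^'n. x $ i) \<in> borel_measurable borel"
  by (intro borel_measurable_continuous_onI continuous_intros)

lemma traj_cong: "(\<And>k. k < n \<Longrightarrow> G k = H k) \<Longrightarrow> traj G v n = traj H v n"
  by (induction n) auto

text \<open>Viewing the state as a function on a product space makes independence of disjoint blocks
  of matrices applicable. \<open>I\<close> may exceed \<open>{..<n}\<close> because the induction
  keeps it fixed.\<close>

lemma traj_measurable:
  assumes "{..<n} \<subseteq> I"
  shows "(\<lambda>f. traj f v n) \<in> borel_measurable (PiM I (\<lambda>_. borel :: (real^'n^'n) measure))"
  using assms
proof (induction n)
  case (Suc n)
  then have [measurable]: "(\<lambda>f. traj f v n) \<in> borel_measurable (PiM I (\<lambda>_. borel :: (real^'n^'n) measure))"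
    by (auto simp: lessThan_Suc)
  have [measurable]: "(\<lambda>f. f n) \<in> borel_measurable (PiM I (\<lambda>_. borel :: (real^'n^'n) measure))"
    using Suc.prems by (intro measurable_component_singleton) auto
  show ?case
    by (rule borel_measurable_vecI) (simp add: matvec_nth)
qed simp

text \<open>With \<open>w\<close> read as probability weights: the variance is half the mean squared
  difference of two independent copies.\<close>

lemma variance_identity:
  fixes w x :: "'n::finite \<Rightarrow> real"
  assumes "(\<Sum>i\<in>UNIV. w i) = 1"
  shows "(\<Sum>i\<in>UNIV. w i * x i)\<^sup>2 =
    (\<Sum>i\<in>UNIV. w i * (x i)\<^sup>2) - (\<Sum>i\<in>UNIV. \<Sum>j\<in>UNIV. w i * w j * (x i - x j)\<^sup>2) / 2"
proof -
  have "(\<Sum>i\<in>UNIV. \<Sum>j\<in>UNIV. w i * w j * (x i - x j)\<^sup>2) =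
    (\<Sum>i\<in>UNIV. \<Sum>j\<in>UNIV. (w i * (x i)\<^sup>2) * w j) + (\<Sum>i\<in>UNIV. \<Sum>j\<in>UNIV. w i * (w j * (x j)\<^sup>2))
      - 2 * (\<Sum>i\<in>UNIV. \<Sum>j\<in>UNIV. (w i * x i) * (w j * x j))"
  proof -
    have "w i * w j * (x i - x j)\<^sup>2 =
        (w i * (x i)\<^sup>2) * w j + w i * (w j * (x j)\<^sup>2) - 2 * ((w i * x i) * (w j * x j))" for i j
      by (simp add: power2_eq_square algebra_simps)
    then show ?thesis
      by (simp only: sum.distrib sum_subtractf sum_distrib_left)
  qed
  also have "\<dots> = 2 * (\<Sum>i\<in>UNIV. w i * (x i)\<^sup>2) - 2 * (\<Sum>i\<in>UNIV. w i * x i)\<^sup>2"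
    unfolding sum_product[symmetric] assms by (simp add: power2_eq_square)
  finally show ?thesis by linarith
qed

text \<open>A locale, so that every result can be reused for the chain started at a later
  time.\<close>

locale stochastic_model = prob_space M for M :: "'w measure" +
  fixes W :: "nat \<Rightarrow> 'w \<Rightarrow> real^'n^'n"
  assumes random_matrix [measurable]: "\<And>k. W k \<in> borel_measurable M"
    and stochastic: "\<And>k \<omega>. \<omega> \<in> space M \<Longrightarrow> stochastic_matrix (W k \<omega>)"
    and indep: "indep_vars (\<lambda>_. borel) W UNIV"
begin

abbreviation state :: "real^'n \<Rightarrow> nat \<Rightarrow> 'w \<Rightarrow> real^'n" where
  "state v n \<omega> \<equiv> traj (\<lambda>k. W k \<omega>) v n"

lemma entry_measurable [measurable]: "(\<lambda>\<omega>. W k \<omega> $ i $ j) \<in> borel_measurable M"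
  by measurable

text \<open>Independence survives reindexing: restrict to the disjoint singletons
  \<open>{t + k}\<close> and read off the only coordinate.\<close>

lemma shift: "stochastic_model M (\<lambda>k. W (t + k))"
proof unfold_locales
  have "indep_vars (\<lambda>k. PiM {t + k} (\<lambda>_. borel)) (\<lambda>k \<omega>. restrict (\<lambda>i. W i \<omega>) {t + k}) UNIV"
    by (rule indep_vars_restrict[OF indep]) (auto simp: disjoint_family_on_def)
  from indep_vars_compose2[OF this, of "\<lambda>k f. f (t + k)" "\<lambda>_. borel"]
  show "indep_vars (\<lambda>_. borel) (\<lambda>k. W (t + k)) UNIV"
    by simp
qed (auto simp: stochastic)

text \<open>The state at time \<open>n\<close> is a function of the matrices before
  \<open>n\<close>, a block disjoint from \<open>{n}\<close>.\<close>

lemma state_indep: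
  fixes f :: "real^'n \<Rightarrow> real" and g :: "real^'n^'n \<Rightarrow> real"
  assumes [measurable]: "f \<in> borel_measurable borel" "g \<in> borel_measurable borel"
  shows "indep_var borel (\<lambda>\<omega>. f (state v n \<omega>)) borel (\<lambda>\<omega>. g (W n \<omega>))"
proof -
  have "indep_var (PiM {..<n} (\<lambda>_. borel)) (\<lambda>\<omega>. restrict (\<lambda>i. W i \<omega>) {..<n})
      (PiM {n} (\<lambda>_. borel)) (\<lambda>\<omega>. restrict (\<lambda>i. W i \<omega>) {n})"
    by (rule indep_var_restrict[OF indep]) auto
  moreover have "(\<lambda>F. f (traj F v n)) \<in> borel_measurable (PiM {..<n} (\<lambda>_. borel))"
    using traj_measurable[OF order.refl, of v n] by measurable
  moreover have "(\<lambda>F. g (F n)) \<in> borel_measurable (PiM {n} (\<lambda>_. borel))"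
    by measurable
  ultimately have "indep_var borel ((\<lambda>F. f (traj F v n)) \<circ> (\<lambda>\<omega>. restrict (\<lambda>i. W i \<omega>) {..<n}))
      borel ((\<lambda>F. g (F n)) \<circ> (\<lambda>\<omega>. restrict (\<lambda>i. W i \<omega>) {n}))"
    by (rule indep_var_compose)
  moreover have "traj (restrict (\<lambda>i. W i \<omega>) {..<n}) v n = state v n \<omega>" for \<omega>
    by (rule traj_cong) simp
  ultimately show ?thesis by (simp add: comp_def)
qed

lemma state_measurable [measurable]: "state v n \<in> borel_measurable M"
proof (induction n)
  case (Suc n)
  note [measurable] = Suc
  show ?case
    by (rule borel_measurable_vecI) (simp add: matvec_nth)
qed simp

lemma state_bound: "\<omega> \<in> space M \<Longrightarrow> \<bar>state v n \<omega> $ i\<bar> \<le> norm v"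
  using traj_bounds[of "\<lambda>k. W k \<omega>" "- norm v" v "norm v" n i] stochastic component_le_norm_cart[of v]
  by (auto simp: abs_le_iff minus_le_iff)

lemma expectation_state_mult:
  fixes f :: "real^'n \<Rightarrow> real" and g :: "real^'n^'n \<Rightarrow> real"
  assumes [measurable]: "f \<in> borel_measurable borel" "g \<in> borel_measurable borel"
    and "integrable M (\<lambda>\<omega>. f (state v n \<omega>))" "integrable M (\<lambda>\<omega>. g (W n \<omega>))"
  shows "expectation (\<lambda>\<omega>. g (W n \<omega>) * f (state v n \<omega>)) =
      expectation (\<lambda>\<omega>. g (W n \<omega>)) * expectation (\<lambda>\<omega>. f (state v n \<omega>))"
    and "integrable M (\<lambda>\<omega>. g (W n \<omega>) * f (state v n \<omega>))"
proof -
  note * = state_indep[OF assms(1,2), of v n] assms(3,4)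
  from indep_var_lebesgue_integral[OF *] indep_var_integrable[OF *]
  show "expectation (\<lambda>\<omega>. g (W n \<omega>) * f (state v n \<omega>)) =
      expectation (\<lambda>\<omega>. g (W n \<omega>)) * expectation (\<lambda>\<omega>. f (state v n \<omega>))"
    and "integrable M (\<lambda>\<omega>. g (W n \<omega>) * f (state v n \<omega>))"
    by (simp_all add: mult.commute)
qed

lemma entry_integrable [simp]: "integrable M (\<lambda>\<omega>. W k \<omega> $ i $ j)"
  using stochastic_matrixD[OF stochastic]
  by (intro integrable_const_bound[where B=1] AE_I2) auto

lemma entry_prod_integrable [simp]: "integrable M (\<lambda>\<omega>. W k \<omega> $ i $ j * W k \<omega> $ i' $ j')"
  using stochastic_matrixD[OF stochastic]
  by (intro integrable_const_bound[where B=1] AE_I2) (auto simp: abs_mult intro: mult_le_one)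

lemma state_integrable [simp]: "integrable M (\<lambda>\<omega>. state v n \<omega> $ i)"
  using state_bound by (intro integrable_const_bound[where B="norm v"] AE_I2) auto

lemma state_diff_integrable [simp]: "integrable M (\<lambda>\<omega>. (state v n \<omega> $ i - state v n \<omega> $ j)\<^sup>2)"
proof (intro integrable_const_bound[where B="(2 * norm v)\<^sup>2"] AE_I2)
  fix \<omega> assume "\<omega> \<in> space M"
  then have "\<bar>state v n \<omega> $ i - state v n \<omega> $ j\<bar> \<le> \<bar>2 * norm v\<bar>"
    using state_bound[of \<omega> v n i] state_bound[of \<omega> v n j] by linarith
  then show "norm ((state v n \<omega> $ i - state v n \<omega> $ j)\<^sup>2) \<le> (2 * norm v)\<^sup>2"
    using abs_le_square_iff[of "state v n \<omega> $ i - state v n \<omega> $ j" "2 * norm v"] by simp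
qed measurable

lemma state_square_integrable [simp]: "integrable M (\<lambda>\<omega>. (state v n \<omega> $ i)\<^sup>2)"
proof (intro integrable_const_bound[where B="(norm v)\<^sup>2"] AE_I2)
  fix \<omega> assume "\<omega> \<in> space M"
  then show "norm ((state v n \<omega> $ i)\<^sup>2) \<le> (norm v)\<^sup>2"
    using abs_le_square_iff[of "state v n \<omega> $ i" "norm v"] state_bound[of \<omega> v n i] by simp
qed measurable

lemma expected_entry: "expected_model M W k $ i $ j = expectation (\<lambda>\<omega>. W k \<omega> $ i $ j)"
  by (simp add: expected_model_def)

lemma expected_stochastic: "stochastic_matrix (expected_model M W k)"
  unfolding stochastic_matrix_def
proof (intro conjI allI)
  show "0 \<le> expected_model M W k $ i $ j" for i j
    unfolding expected_entry using stochastic_matrixD[OF stochastic]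
    by (intro integral_nonneg_AE AE_I2) auto
  show "(\<Sum>j\<in>UNIV. expected_model M W k $ i $ j) = 1" for i
  proof -
    have "(\<Sum>j\<in>UNIV. expected_model M W k $ i $ j) = expectation (\<lambda>\<omega>. \<Sum>j\<in>UNIV. W k \<omega> $ i $ j)"
      unfolding expected_entry by (rule Bochner_Integration.integral_sum[symmetric]) simp
    also have "\<dots> = expectation (\<lambda>\<omega>. 1)"
      by (rule Bochner_Integration.integral_cong) (auto simp: stochastic_matrixD[OF stochastic])
    finally show ?thesis by (simp add: prob_space)
  qed
qed

lemma flow_expected: "flow S (expected_model M W k) = expectation (\<lambda>\<omega>. flow S (W k \<omega>))"
  by (simp add: flow_def expected_entry)

lemma flow_integrable: "integrable M (\<lambda>\<omega>. flow S (W k \<omega>))"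
  by (simp add: flow_def)

text \<open>By independence of the state and the next matrix, expectation commutes with each step of
  the recursion.\<close>

lemma expected_traj: "traj (expected_model M W) v n $ i = expectation (\<lambda>\<omega>. state v n \<omega> $ i)"
proof (induction n arbitrary: i)
  case 0
  then show ?case by (simp add: prob_space)
next
  case (Suc n)
  have *: "expectation (\<lambda>\<omega>. W n \<omega> $ i $ j * state v n \<omega> $ j) =
      expectation (\<lambda>\<omega>. W n \<omega> $ i $ j) * expectation (\<lambda>\<omega>. state v n \<omega> $ j)"
    "integrable M (\<lambda>\<omega>. W n \<omega> $ i $ j * state v n \<omega> $ j)" for j
    using expectation_state_mult[of "\<lambda>x. x $ j" "\<lambda>A. A $ i $ j" v n] by simp_all
  show ?case
    by (simp add: matvec_nth Suc expected_entry *)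
qed

section \<open>Infinite flow and ergodicity: from the model to its expectation\<close>

lemma infinite_flow_model_iff:
  "infinite_flow_model M W \<longleftrightarrow>
     (\<forall>S. S \<noteq> {} \<and> S \<noteq> UNIV \<longrightarrow> (AE \<omega> in M. \<not> summable (\<lambda>k. flow S (W k \<omega>))))"
proof -
  have "infinite_flow_model M W \<longleftrightarrow>
      (AE \<omega> in M. \<forall>S. S \<noteq> {} \<and> S \<noteq> UNIV \<longrightarrow> \<not> summable (\<lambda>k. flow S (W k \<omega>)))"
    unfolding infinite_flow_model_def
    by (intro AE_cong infinite_flow_iff_summable stochastic)
  \<comment> \<open>There are only finitely many cuts, so each may have its own null set.\<close>
  then show ?thesis
    by (simp add: AE_all_countable)
qed

theorem infinite_flow_expected_iff:
  "infinite_flow_model M W \<longleftrightarrow> infinite_flow (expected_model M W)"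
proof -
  have "(AE \<omega> in M. \<not> summable (\<lambda>k. flow S (W k \<omega>))) \<longleftrightarrow>
      \<not> summable (\<lambda>k. flow S (expected_model M W k))" for S
  proof
    assume ae: "AE \<omega> in M. \<not> summable (\<lambda>k. flow S (W k \<omega>))"
    show "\<not> summable (\<lambda>k. flow S (expected_model M W k))"
    proof
      assume "summable (\<lambda>k. flow S (expected_model M W k))"
      then have "AE \<omega> in M. summable (\<lambda>k. flow S (W k \<omega>))"
        by (intro AE_summable_if_expectation_summable flow_integrable flow_nonneg stochastic)
          (auto simp: flow_expected)
      with ae have "AE \<omega> in M. False" by eventually_elim auto
      then show False by simp
    qed
  next
    assume ns: "\<not> summable (\<lambda>k. flow S (expected_model M W k))"
    \<comment> \<open>The bound of \<open>flow_le\<close>, which rescales the flows into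
      \<open>[0, 1]\<close>.\<close>
    define c where "c = 2 * real (CARD('n)) ^ 2"
    have c: "0 < c" by (simp add: c_def)
    have flow_borel: "flow S \<in> borel_measurable borel"
      unfolding flow_def[abs_def] by measurable
    have "AE \<omega> in M. \<not> summable (\<lambda>k. flow S (W k \<omega>) / c)"
    proof (rule AE_not_summable_if_indep)
      show "indep_vars (\<lambda>_. borel) (\<lambda>k \<omega>. flow S (W k \<omega>) / c) UNIV"
        by (rule indep_vars_compose2[OF indep]) (intro borel_measurable_divide flow_borel borel_measurable_const)
      show "0 \<le> flow S (W k \<omega>) / c" "flow S (W k \<omega>) / c \<le> 1" if "\<omega> \<in> space M" for k \<omega>
        using flow_nonneg[OF stochastic[OF that]] flow_le[OF stochastic[OF that]] c
        by (auto simp: c_def)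
      show "\<not> summable (\<lambda>k. expectation (\<lambda>\<omega>. flow S (W k \<omega>) / c))"
        using ns c by (simp add: flow_expected flow_integrable summable_divide_iff)
    qed
    then show "AE \<omega> in M. \<not> summable (\<lambda>k. flow S (W k \<omega>))"
      using c by (simp add: summable_divide_iff)
  qed
  then show ?thesis
    by (simp add: infinite_flow_model_iff infinite_flow_iff_summable[OF expected_stochastic])
qed

theorem ergodic_imp_expected_ergodic:
  assumes "ergodic_model M W"
  shows "ergodic_chain (expected_model M W)"
  unfolding ergodic_chain_iff_traj
proof (intro allI)
  fix t :: nat and j :: 'n
  interpret V: stochastic_model M "\<lambda>k. W (t + k)"
    by (rule shift)
  let ?x = "V.state (axis j 1)"
  \<comment> \<open>Taking \<open>lim\<close> of a single coordinate makes the limit measurable;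
    almost surely it is the common limit of all coordinates.\<close>
  define g where "g \<omega> = lim (\<lambda>n. ?x n \<omega> $ undefined)" for \<omega>
  have [measurable]: "g \<in> borel_measurable M"
    unfolding g_def by measurable
  have lim: "AE \<omega> in M. \<forall>i. (\<lambda>n. ?x n \<omega> $ i) \<longlonglongrightarrow> g \<omega>"
    using assms unfolding ergodic_model_def ergodic_chain_iff_traj
  proof eventually_elim
    case (elim \<omega>)
    then obtain c where "\<forall>i. (\<lambda>n. ?x n \<omega> $ i) \<longlonglongrightarrow> c"
      by blast
    moreover from this have "g \<omega> = c"
      unfolding g_def by (intro limI) auto
    ultimately show ?case by simp
  qed
  have "(\<lambda>n. expectation (\<lambda>\<omega>. ?x n \<omega> $ i)) \<longlonglongrightarrow> expectation g" for i
  proof (rule integral_dominated_convergence[where w="\<lambda>_. norm (axis j 1 :: real^'n)"])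
    show "AE \<omega> in M. (\<lambda>n. ?x n \<omega> $ i) \<longlonglongrightarrow> g \<omega>"
      using lim by eventually_elim auto
    show "AE \<omega> in M. norm (?x n \<omega> $ i) \<le> norm (axis j 1 :: real^'n)" for n
      by (rule AE_I2) (use V.state_bound[of _ "axis j 1"] in auto)
  qed simp_all
  moreover have "(\<lambda>k. expected_model M W (t + k)) = expected_model M (\<lambda>k. W (t + k))"
    by (simp add: expected_model_def fun_eq_iff)
  ultimately show "\<exists>g. \<forall>i. (\<lambda>n. traj (\<lambda>k. expected_model M W (t + k)) (axis j 1) n $ i) \<longlonglongrightarrow> g"
    by (auto simp: V.expected_traj)
qed

subsection \<open>Dissipation of the weighted second moment\<close>

lemma dissipation_expectation:
  "expectation (\<lambda>\<omega>. dissipation (W n \<omega>) (state v n \<omega>)) =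
     (\<Sum>i\<in>UNIV. \<Sum>j\<in>UNIV. (expected_model M W n $ i $ j + expected_model M W n $ j $ i) *
        expectation (\<lambda>\<omega>. (state v n \<omega> $ i - state v n \<omega> $ j)\<^sup>2))"
  "integrable M (\<lambda>\<omega>. dissipation (W n \<omega>) (state v n \<omega>))"
proof -
  have *: "expectation (\<lambda>\<omega>. (W n \<omega> $ i $ j + W n \<omega> $ j $ i) * (state v n \<omega> $ i - state v n \<omega> $ j)\<^sup>2) =
      expectation (\<lambda>\<omega>. W n \<omega> $ i $ j + W n \<omega> $ j $ i) * expectation (\<lambda>\<omega>. (state v n \<omega> $ i - state v n \<omega> $ j)\<^sup>2)"
    "integrable M (\<lambda>\<omega>. (W n \<omega> $ i $ j + W n \<omega> $ j $ i) * (state v n \<omega> $ i - state v n \<omega> $ j)\<^sup>2)" for i j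
    by (rule expectation_state_mult[of "\<lambda>x. (x $ i - x $ j)\<^sup>2" "\<lambda>A. A $ i $ j + A $ j $ i" v n]; simp)+
  show "expectation (\<lambda>\<omega>. dissipation (W n \<omega>) (state v n \<omega>)) =
     (\<Sum>i\<in>UNIV. \<Sum>j\<in>UNIV. (expected_model M W n $ i $ j + expected_model M W n $ j $ i) *
        expectation (\<lambda>\<omega>. (state v n \<omega> $ i - state v n \<omega> $ j)\<^sup>2))"
    "integrable M (\<lambda>\<omega>. dissipation (W n \<omega>) (state v n \<omega>))"
    by (simp_all add: dissipation_def * expected_entry)
qed

text \<open>Apply \<open>variance_identity\<close> with row \<open>l\<close> of \<open>W n\<close>
  as weights, then factor every expectation by independence.\<close>

lemma second_moment_step:
  "expectation (\<lambda>\<omega>. (state v (Suc n) \<omega> $ l)\<^sup>2) =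
     (\<Sum>i\<in>UNIV. expected_model M W n $ l $ i * expectation (\<lambda>\<omega>. (state v n \<omega> $ i)\<^sup>2))
     - (\<Sum>i\<in>UNIV. \<Sum>j\<in>UNIV. expectation (\<lambda>\<omega>. W n \<omega> $ l $ i * W n \<omega> $ l $ j) *
          expectation (\<lambda>\<omega>. (state v n \<omega> $ i - state v n \<omega> $ j)\<^sup>2)) / 2"
proof -
  have 1: "expectation (\<lambda>\<omega>. W n \<omega> $ l $ i * (state v n \<omega> $ i)\<^sup>2) =
      expectation (\<lambda>\<omega>. W n \<omega> $ l $ i) * expectation (\<lambda>\<omega>. (state v n \<omega> $ i)\<^sup>2)"
    "integrable M (\<lambda>\<omega>. W n \<omega> $ l $ i * (state v n \<omega> $ i)\<^sup>2)" for i
    by (rule expectation_state_mult[of "\<lambda>x. (x $ i)\<^sup>2" "\<lambda>A. A $ l $ i" v n]; simp)+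
  have 2: "expectation (\<lambda>\<omega>. (W n \<omega> $ l $ i * W n \<omega> $ l $ j) * (state v n \<omega> $ i - state v n \<omega> $ j)\<^sup>2) =
      expectation (\<lambda>\<omega>. W n \<omega> $ l $ i * W n \<omega> $ l $ j) * expectation (\<lambda>\<omega>. (state v n \<omega> $ i - state v n \<omega> $ j)\<^sup>2)"
    "integrable M (\<lambda>\<omega>. (W n \<omega> $ l $ i * W n \<omega> $ l $ j) * (state v n \<omega> $ i - state v n \<omega> $ j)\<^sup>2)" for i j
    by (rule expectation_state_mult[of "\<lambda>x. (x $ i - x $ j)\<^sup>2" "\<lambda>A. A $ l $ i * A $ l $ j" v n]; simp)+
  have "expectation (\<lambda>\<omega>. (state v (Suc n) \<omega> $ l)\<^sup>2) = expectation (\<lambda>\<omega>.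
      (\<Sum>i\<in>UNIV. W n \<omega> $ l $ i * (state v n \<omega> $ i)\<^sup>2)
     - (\<Sum>i\<in>UNIV. \<Sum>j\<in>UNIV. (W n \<omega> $ l $ i * W n \<omega> $ l $ j) * (state v n \<omega> $ i - state v n \<omega> $ j)\<^sup>2) / 2)"
    by (rule Bochner_Integration.integral_cong)
      (auto simp: matvec_nth variance_identity stochastic_matrixD[OF stochastic])
  then show ?thesis
    by (simp add: 1 2 expected_entry)
qed

text \<open>Weighted by \<pi>, the linear part of \<open>second_moment_step\<close> reproduces the
  old moment because \<pi> is steady. In the quadratic part, bounding \<pi> below by
  \<open>p\<close> and summing over rows produces the inner products of columns that weak feedback
  controls.\<close>

lemma second_moment_decrease:
  assumes steady: "common_steady_state M W \<pi>"
    and p: "\<And>i. p \<le> \<pi> $ i" "0 < p"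
    and feedback: "\<And>k i j. i \<noteq> j \<Longrightarrow>
        \<gamma> * (expected_model M W k $ i $ j + expected_model M W k $ j $ i)
          \<le> expectation (\<lambda>\<omega>. column i (W k \<omega>) \<bullet> column j (W k \<omega>))"
  shows "(\<Sum>l\<in>UNIV. \<pi> $ l * expectation (\<lambda>\<omega>. (state v (Suc n) \<omega> $ l)\<^sup>2))
    \<le> (\<Sum>l\<in>UNIV. \<pi> $ l * expectation (\<lambda>\<omega>. (state v n \<omega> $ l)\<^sup>2))
      - p * \<gamma> / 2 * expectation (\<lambda>\<omega>. dissipation (W n \<omega>) (state v n \<omega>))"
proof -
  let ?E = "expected_model M W n"
  let ?m = "\<lambda>i. expectation (\<lambda>\<omega>. (state v n \<omega> $ i)\<^sup>2)"
  let ?r = "\<lambda>i j. expectation (\<lambda>\<omega>. (state v n \<omega> $ i - state v n \<omega> $ j)\<^sup>2)"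
  let ?c = "\<lambda>l i j. expectation (\<lambda>\<omega>. W n \<omega> $ l $ i * W n \<omega> $ l $ j)"
  have c0: "0 \<le> ?c l i j" for l i j
    using stochastic_matrixD[OF stochastic] by (intro integral_nonneg_AE AE_I2) auto
  have r0: "0 \<le> ?r i j" for i j
    by (intro integral_nonneg_AE AE_I2) auto
  have inner: "expectation (\<lambda>\<omega>. column i (W n \<omega>) \<bullet> column j (W n \<omega>)) = (\<Sum>l\<in>UNIV. ?c l i j)" for i j
    by (simp add: inner_vec_def column_def)
  \<comment> \<open>For \<open>i = j\<close> both sides vanish, since \<open>?r i i\<close> is 0; so
    feedback off the diagonal suffices.\<close>
  have pair: "p * \<gamma> * (?E $ i $ j + ?E $ j $ i) * ?r i j \<le> (\<Sum>l\<in>UNIV. \<pi> $ l * ?c l i j) * ?r i j" for i j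
  proof (cases "i = j")
    case False
    have "p * \<gamma> * (?E $ i $ j + ?E $ j $ i) \<le> p * (\<Sum>l\<in>UNIV. ?c l i j)"
      using mult_left_mono[OF feedback[OF False, of n], of p] p by (simp add: inner mult.assoc)
    also have "\<dots> \<le> (\<Sum>l\<in>UNIV. \<pi> $ l * ?c l i j)"
      unfolding sum_distrib_left by (intro sum_mono mult_right_mono p c0)
    finally show ?thesis
      by (intro mult_right_mono r0)
  qed simp
  have steady': "(\<Sum>l\<in>UNIV. \<pi> $ l * ?E $ l $ i) = \<pi> $ i" for i
  proof -
    have "(\<pi> v* ?E) $ i = \<pi> $ i"
      using steady by (simp add: common_steady_state_def)
    then show ?thesis
      by (simp add: vector_matrix_mult_def mult.commute)
  qed
  have "(\<Sum>l\<in>UNIV. \<pi> $ l * (\<Sum>i\<in>UNIV. ?E $ l $ i * ?m i)) = (\<Sum>i\<in>UNIV. (\<Sum>l\<in>UNIV. \<pi> $ l * ?E $ l $ i) * ?m i)"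
    unfolding sum_distrib_left sum_distrib_right by (subst sum.swap) (simp add: mult.assoc)
  then have A: "(\<Sum>l\<in>UNIV. \<pi> $ l * (\<Sum>i\<in>UNIV. ?E $ l $ i * ?m i)) = (\<Sum>i\<in>UNIV. \<pi> $ i * ?m i)"
    unfolding steady' .
  have "p * \<gamma> * expectation (\<lambda>\<omega>. dissipation (W n \<omega>) (state v n \<omega>))
      = (\<Sum>i\<in>UNIV. \<Sum>j\<in>UNIV. p * \<gamma> * (?E $ i $ j + ?E $ j $ i) * ?r i j)"
    unfolding dissipation_expectation sum_distrib_left by (simp add: mult.assoc)
  also have "\<dots> \<le> (\<Sum>i\<in>UNIV. \<Sum>j\<in>UNIV. (\<Sum>l\<in>UNIV. \<pi> $ l * ?c l i j) * ?r i j)"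
    by (intro sum_mono pair)
  also have "\<dots> = (\<Sum>i\<in>UNIV. \<Sum>l\<in>UNIV. \<Sum>j\<in>UNIV. \<pi> $ l * (?c l i j * ?r i j))"
    unfolding sum_distrib_right mult.assoc by (intro sum.cong refl sum.swap)
  also have "\<dots> = (\<Sum>l\<in>UNIV. \<Sum>i\<in>UNIV. \<Sum>j\<in>UNIV. \<pi> $ l * (?c l i j * ?r i j))"
    by (rule sum.swap)
  also have "\<dots> = (\<Sum>l\<in>UNIV. \<pi> $ l * (\<Sum>i\<in>UNIV. \<Sum>j\<in>UNIV. ?c l i j * ?r i j))"
    by (simp only: sum_distrib_left)
  finally have B: "p * \<gamma> / 2 * expectation (\<lambda>\<omega>. dissipation (W n \<omega>) (state v n \<omega>))
      \<le> (\<Sum>l\<in>UNIV. \<pi> $ l * ((\<Sum>i\<in>UNIV. \<Sum>j\<in>UNIV. ?c l i j * ?r i j) / 2))"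
    by (simp add: sum_divide_distrib[symmetric])
  show ?thesis
    unfolding second_moment_step right_diff_distrib sum_subtractf A using B by simp
qed

text \<open>Telescoping the decrease bounds the total expected dissipation by the initial weighted
  moment divided by \<open>p * \<gamma> / 2\<close>.\<close>

lemma AE_dissipation_summable:
  assumes "common_steady_state M W \<pi>" and "\<And>i. p \<le> \<pi> $ i" "0 < p" and "0 < \<gamma>"
    and "\<And>k i j. i \<noteq> j \<Longrightarrow>
        \<gamma> * (expected_model M W k $ i $ j + expected_model M W k $ j $ i)
          \<le> expectation (\<lambda>\<omega>. column i (W k \<omega>) \<bullet> column j (W k \<omega>))"
  shows "AE \<omega> in M. summable (\<lambda>n. dissipation (W n \<omega>) (state v n \<omega>))"
proof (rule AE_summable_if_expectation_summable)
  let ?d = "\<lambda>n. expectation (\<lambda>\<omega>. dissipation (W n \<omega>) (state v n \<omega>))"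
  let ?U = "\<lambda>n. \<Sum>l\<in>UNIV. \<pi> $ l * expectation (\<lambda>\<omega>. (state v n \<omega> $ l)\<^sup>2)"
  show "integrable M (\<lambda>\<omega>. dissipation (W n \<omega>) (state v n \<omega>))" for n
    by (rule dissipation_expectation)
  show nn: "0 \<le> dissipation (W n \<omega>) (state v n \<omega>)" if "\<omega> \<in> space M" for n \<omega>
    by (rule dissipation_nonneg[OF stochastic[OF that]])
  have pi0: "0 \<le> \<pi> $ l" for l
    using assms(2)[of l] assms(3) by simp
  have step: "?U (Suc n) \<le> ?U n - p * \<gamma> / 2 * ?d n" for n
    by (rule second_moment_decrease[OF assms(1,2,3,5)])
  have "p * \<gamma> / 2 * (\<Sum>k<n. ?d k) \<le> ?U 0 - ?U n" for n
  proof (induction n)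
    case (Suc n)
    then show ?case
      using step[of n] by (simp only: sum.lessThan_Suc distrib_left)
  qed simp
  moreover have "?U 0 - ?U n \<le> ?U 0" for n
    by (simp add: sum_nonneg pi0 integral_nonneg_AE)
  ultimately have "p * \<gamma> / 2 * (\<Sum>k<n. ?d k) \<le> ?U 0" for n
    by (rule order.trans)
  then have "(\<Sum>k<n. ?d k) \<le> ?U 0 / (p * \<gamma> / 2)" for n
    using assms(3,4) by (subst pos_le_divide_eq) (auto simp: mult.commute)
  then show "summable ?d"
    by (intro summableI_nonneg_bounded integral_nonneg_AE AE_I2 nn)
qed

end

subsection \<open>Equivalence\<close>

text \<open>Each start time and basis vector is treated in a shifted model, which inherits steady
  state, feedback and infinite flow. There are countably many such pairs, so the exceptional null
  sets can be united.\<close>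

theorem (in stochastic_model) infinite_flow_imp_ergodic:
  assumes steady: "common_steady_state M W \<pi>" and pos: "\<forall>i. \<pi> $ i > 0"
    and feedback: "weak_feedback M W" and inf: "infinite_flow_model M W"
  shows "ergodic_model M W"
proof -
  obtain \<gamma> where \<gamma>: "0 < \<gamma>" and fb: "\<And>k i j. i \<noteq> j \<Longrightarrow>
        \<gamma> * (expected_model M W k $ i $ j + expected_model M W k $ j $ i)
          \<le> expectation (\<lambda>\<omega>. column i (W k \<omega>) \<bullet> column j (W k \<omega>))"
    using feedback unfolding weak_feedback_def expected_entry by blast
  define p where "p = Min (range (($) \<pi>))"
  have p: "p \<le> \<pi> $ i" "0 < p" for i
    using pos by (auto simp: p_def)
  have consensus: "AE \<omega> in M. \<exists>g. \<forall>i. (\<lambda>n. traj (\<lambda>k. W (t + k) \<omega>) (axis j 1) n $ i) \<longlonglongrightarrow> g"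
    for t :: nat and j :: 'n
  proof -
    interpret V: stochastic_model M "\<lambda>k. W (t + k)"
      by (rule shift)
    have E: "expected_model M (\<lambda>k. W (t + k)) k = expected_model M W (t + k)" for k
      by (simp add: expected_model_def)
    have "common_steady_state M (\<lambda>k. W (t + k)) \<pi>"
      using steady by (simp add: common_steady_state_def E)
    then have "AE \<omega> in M. summable (\<lambda>n. dissipation (W (t + n) \<omega>) (V.state (axis j 1) n \<omega>))"
      by (rule V.AE_dissipation_summable[OF _ p \<gamma>]) (simp add: E fb)
    moreover have "AE \<omega> in M. infinite_flow (\<lambda>k. W k \<omega>)"
      using inf by (simp add: infinite_flow_model_def)
    ultimately show ?thesis
      using AE_space
    proof eventually_elim
      case (elim \<omega>)
      have "\<not> summable (\<lambda>k. flow S (W (t + k) \<omega>))" if "S \<noteq> {}" "S \<noteq> UNIV" for S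
        using elim(2) that summable_iff_shift[of "\<lambda>k. flow S (W k \<omega>)" t]
        by (simp add: infinite_flow_iff_summable[OF stochastic[OF elim(3)]] add.commute)
      then show ?case
        by (intro consensus_if_dissipation_summable elim(1) stochastic elim(3))
    qed
  qed
  then have "AE \<omega> in M. \<forall>t j. \<exists>g. \<forall>i. (\<lambda>n. traj (\<lambda>k. W (t + k) \<omega>) (axis j 1) n $ i) \<longlonglongrightarrow> g"
    unfolding AE_all_countable by blast
  then show ?thesis
    unfolding ergodic_model_def ergodic_chain_iff_traj .
qed

theorem theorem7:
  fixes M :: "'w measure"
    and W :: "nat \<Rightarrow> 'w \<Rightarrow> real^'n^'n"
    and \<pi> :: "real^'n"
  assumes "independent_model M W"
    and "common_steady_state M W \<pi>"
    and "\<forall>i. \<pi> $ i > 0"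
    and "weak_feedback M W"
  shows "(ergodic_model M W \<longleftrightarrow> infinite_flow_model M W)
       \<and> (infinite_flow_model M W \<longleftrightarrow> infinite_flow (expected_model M W))
       \<and> (infinite_flow (expected_model M W) \<longleftrightarrow> ergodic_chain (expected_model M W))"
proof -
  interpret stochastic_model M W
    using assms(1) unfolding independent_model_def random_model_def
    by (intro stochastic_model.intro stochastic_model_axioms.intro) auto
  have "infinite_flow_model M W \<Longrightarrow> ergodic_model M W"
    by (rule infinite_flow_imp_ergodic[OF assms(2-4)])
  moreover have "ergodic_chain (expected_model M W) \<Longrightarrow> infinite_flow (expected_model M W)"
    by (rule ergodic_imp_infinite_flow[OF expected_stochastic])
  \<comment> \<open>The cycle runs from the ergodic model to the ergodic expected model, to infinite
    flow in expectation, to infinite flow almost surely, and back.\<close>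
  ultimately show ?thesis
    using ergodic_imp_expected_ergodic infinite_flow_expected_iff by blast
qed

end
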